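(* Every output $X$ of the global maximum-edge round algorithm is an exact-EF1 matching. Moreover, let $t=\delta(A)$ and define $$\Gamma_m(t)=\max\left\{t,\frac{1}{m-(m-1)t}\right\},\qquad u_m(t)=t+\frac{1-t}{m}.$$ Then $$\alpha(X)\ge\Gamma_m(t),\qquad \frac{\mathrm{SW}(X)}{\mathrm{OPT}}\ge u_m(t)$$ (the welfare ratio being considered when $\mathrm{OPT}>0$).
   Context: Market: $F=\{1,\dots,m\}$ is the set of firms, $W=\{1,\dots,n\}$ the set of workers; firm $i$ values worker $j$ at $a_{ij}\ge 0$, $A=(a_{ij})$, additively: $V_i(T)=\sum_{j\in T}a_{ij}$. A complete matching $X=(X_1,\dots,X_m)$ is a partition of $W$ (parts may be empty). Put $M_j=\max_i a_{ij}$, $B_i=V_i(X_i)$, $\mathrm{SW}(X)=\sum_i B_i$, $\mathrm{OPT}=\sum_j M_j$. If some $a_{ij}>0$, $\delta(A)=\min_{a_{ij}>0}a_{ij}/M_j$; for the all-zero market $\delta(A)=1$. EF1: $X$ is EF1 if for every pair of firms $i,k$ with $X_k\neq\varnothing$ there is $g\in X_k$ with $V_i(X_i)\ge V_i(X_k\setminus\{g\})$. Core: profits $x_i\ge 0$ and wages $y_j\ge 0$ satisfy local financing if $x_i+\sum_{j\in X_i}y_j=B_i$ for all $i$. $(X,x,y)$ is in the $\alpha$-core if $\sum_{i\in I}x_i+\sum_{j\in T}y_j\ge\alpha\sum_{j\in T}\max_{i\in I}a_{ij}$ for all nonempty $I\subseteq F$ and all $T\subseteq W$. $\alpha(X)$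 is the largest $\alpha$ (supremum in $[0,+\infty]$) for which some nonnegative $x,y$ satisfying local financing make $(X,x,y)$ an element of the $\alpha$-core. Global maximum-edge round algorithm: start with all $X_i=\varnothing$ and unassigned set $U=W$. While there are $i\in F$, $j\in U$ with $a_{ij}>0$: start a new round with active firm set $S=F$; while there are $i\in S$, $j\in U$ with $a_{ij}>0$, choose (ties broken arbitrarily) a pair $(i^*,j^* )\in S\times U$ maximizing $a_{ij}$ among all pairs in $S\times U$ with $a_{ij}>0$, add $j^*$ to $X_{i^*}$, remove $j^*$ from $U$ and remove $i^*$ from $S$. Finally, assign the remaining workers (those with $a_{ij}=0$ for all $i$) arbitrarily. *)

theory Defs
  imports "HOL-Library.Extended_Nonnegative_Real" "HOL-Library.Disjoint_Sets"
begin

text \<open>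
  A market is given by the numbers m of firms and n of workers and a valuation
  a; only the values a i j with i in 1..m and j in 1..n are relevant.
  A matching maps each firm to the set of workers assigned to it.
\<close>

definition val :: "(nat \<Rightarrow> nat \<Rightarrow> real) \<Rightarrow> nat \<Rightarrow> nat set \<Rightarrow> real" where
  "val a i T = (\<Sum>j\<in>T. a i j)"

definition complete_matching :: "nat \<Rightarrow> nat \<Rightarrow> (nat \<Rightarrow> nat set) \<Rightarrow> bool" where
  "complete_matching m n X \<longleftrightarrow>
     (\<Union>i\<in>{1..m}. X i) = {1..n} \<and> disjoint_family_on X {1..m}"

definition max_val :: "nat \<Rightarrow> (nat \<Rightarrow> nat \<Rightarrow> real) \<Rightarrow> nat \<Rightarrow> real" where
  "max_val m a j = Max ((\<lambda>i. a i j) ` {1..m})"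

definition welfare :: "nat \<Rightarrow> (nat \<Rightarrow> nat \<Rightarrow> real) \<Rightarrow> (nat \<Rightarrow> nat set) \<Rightarrow> real" where
  "welfare m a X = (\<Sum>i\<in>{1..m}. val a i (X i))"

definition opt_welfare :: "nat \<Rightarrow> nat \<Rightarrow> (nat \<Rightarrow> nat \<Rightarrow> real) \<Rightarrow> real" where
  "opt_welfare m n a = (\<Sum>j\<in>{1..n}. max_val m a j)"

definition delta :: "nat \<Rightarrow> nat \<Rightarrow> (nat \<Rightarrow> nat \<Rightarrow> real) \<Rightarrow> real" where
  "delta m n a =
     (if \<exists>i\<in>{1..m}. \<exists>j\<in>{1..n}. a i j > 0
      then Min {a i j / max_val m a j | i j. i \<in> {1..m} \<and> j \<in> {1..n} \<and> a i j > 0}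
      else 1)"

definition EF1 :: "nat \<Rightarrow> (nat \<Rightarrow> nat \<Rightarrow> real) \<Rightarrow> (nat \<Rightarrow> nat set) \<Rightarrow> bool" where
  "EF1 m a X \<longleftrightarrow>
     (\<forall>i\<in>{1..m}. \<forall>k\<in>{1..m}. X k \<noteq> {} \<longrightarrow>
        (\<exists>g\<in>X k. val a i (X i) \<ge> val a i (X k - {g})))"

definition local_financing ::
  "nat \<Rightarrow> (nat \<Rightarrow> nat \<Rightarrow> real) \<Rightarrow> (nat \<Rightarrow> nat set) \<Rightarrow> (nat \<Rightarrow> real) \<Rightarrow> (nat \<Rightarrow> real) \<Rightarrow> bool" where
  "local_financing m a X x y \<longleftrightarrow>
     (\<forall>i\<in>{1..m}. x i + (\<Sum>j\<in>X i. y j) = val a i (X i))"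

definition in_core ::
  "nat \<Rightarrow> nat \<Rightarrow> (nat \<Rightarrow> nat \<Rightarrow> real) \<Rightarrow> real \<Rightarrow> (nat \<Rightarrow> real) \<Rightarrow> (nat \<Rightarrow> real) \<Rightarrow> bool" where
  "in_core m n a \<alpha> x y \<longleftrightarrow>
     (\<forall>I T. I \<noteq> {} \<and> I \<subseteq> {1..m} \<and> T \<subseteq> {1..n} \<longrightarrow>
        (\<Sum>i\<in>I. x i) + (\<Sum>j\<in>T. y j) \<ge> \<alpha> * (\<Sum>j\<in>T. Max ((\<lambda>i. a i j) ` I)))"

definition core_ratio ::
  "nat \<Rightarrow> nat \<Rightarrow> (nat \<Rightarrow> nat \<Rightarrow> real) \<Rightarrow> (nat \<Rightarrow> nat set) \<Rightarrow> ennreal" where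
  "core_ratio m n a X =
     Sup {ennreal \<alpha> | \<alpha>. \<alpha> \<ge> 0 \<and>
       (\<exists>x y. (\<forall>i\<in>{1..m}. x i \<ge> 0) \<and> (\<forall>j\<in>{1..n}. y j \<ge> 0) \<and>
              local_financing m a X x y \<and> in_core m n a \<alpha> x y)}"

text \<open>
  Big-step semantics of the two nested loops. Ties are broken arbitrarily, so
  both are relations between a state and the possible results. The inner loop
  works on (X, U, S), with U the unassigned workers and S the firms still
  active in the current round.
\<close>

definition positive_pair :: "(nat \<Rightarrow> nat \<Rightarrow> real) \<Rightarrow> nat set \<Rightarrow> nat set \<Rightarrow> bool" where
  "positive_pair a S U \<longleftrightarrow> (\<exists>i\<in>S. \<exists>j\<in>U. a i j > 0)"

inductive run_round ::
  "(nat \<Rightarrow> nat \<Rightarrow> real) \<Rightarrow> (nat \<Rightarrow> nat set) \<Rightarrow> nat set \<Rightarrow> nat set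
     \<Rightarrow> (nat \<Rightarrow> nat set) \<Rightarrow> nat set \<Rightarrow> bool"
  for a where
  round_end: "\<not> positive_pair a S U \<Longrightarrow> run_round a X U S X U"
| round_pick: "\<lbrakk> i \<in> S; j \<in> U; a i j > 0; \<forall>i'\<in>S. \<forall>j'\<in>U. a i' j' > 0 \<longrightarrow> a i' j' \<le> a i j;
     run_round a (X(i := insert j (X i))) (U - {j}) (S - {i}) X' U' \<rbrakk>
   \<Longrightarrow> run_round a X U S X' U'"

inductive run_rounds ::
  "nat \<Rightarrow> (nat \<Rightarrow> nat \<Rightarrow> real) \<Rightarrow> (nat \<Rightarrow> nat set) \<Rightarrow> nat set
     \<Rightarrow> (nat \<Rightarrow> nat set) \<Rightarrow> nat set \<Rightarrow> bool"
  for m a where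
  rounds_end: "\<not> positive_pair a {1..m} U \<Longrightarrow> run_rounds m a X U X U"
| rounds_next: "\<lbrakk> positive_pair a {1..m} U; run_round a X U {1..m} X' U';
     run_rounds m a X' U' X'' U'' \<rbrakk>
   \<Longrightarrow> run_rounds m a X U X'' U''"

text \<open>The function r is the arbitrary assignment of the leftover workers.\<close>

definition gme_output ::
  "nat \<Rightarrow> nat \<Rightarrow> (nat \<Rightarrow> nat \<Rightarrow> real) \<Rightarrow> (nat \<Rightarrow> nat set) \<Rightarrow> bool" where
  "gme_output m n a X \<longleftrightarrow>
     (\<exists>X\<^sub>0 U\<^sub>0 r. run_rounds m a (\<lambda>_. {}) {1..n} X\<^sub>0 U\<^sub>0 \<and>
        (\<forall>j\<in>U\<^sub>0. r j \<in> {1..m}) \<and>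
        X = (\<lambda>i. X\<^sub>0 i \<union> {j \<in> U\<^sub>0. r j = i}))"

definition core_bound :: "nat \<Rightarrow> real \<Rightarrow> real" where
  "core_bound m t = max t (1 / (real m - (real m - 1) * t))"

definition welfare_bound :: "nat \<Rightarrow> real \<Rightarrow> real" where
  "welfare_bound m t = t + (1 - t) / real m"

end

theory Submission imports Defs begin

text \<open>
  EF1: if a firm i picks p in some round, every worker g that firm k receives in a later round
  was still available then, so i values p at least as much as g; if i picks nothing, it values
  g at 0. Matching the picks of i in round r with those of k in round r + 1 bounds the value of
  i for everything k owns except for the first pick of k.

  Core and welfare: let p j be the value of worker j for its employer, so t * M j \<le> p j. Fix a
  set I of firms and let v be the first value picked by a firm of I in a given round. Up to that
  moment every picked j satisfies a i j \<le> p j for all i in I, and the at most m - 1 workers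
  picked afterwards satisfy a i j \<le> v. So in each round the total loss of the late picks is
  bounded by c (m - 1) v, with c = 1 - t, which the value v itself pays for. With
  \<alpha> = 1 / (m - (m - 1) t), profits (1 - \<alpha>) V i (X i) and wages \<alpha> p j lie in the
  \<alpha>-core; zero profits and wages p j lie in the t-core. The welfare bound is the same
  counting for the set I of all firms.
\<close>

definition bundle_sum :: "nat \<Rightarrow> (nat \<Rightarrow> nat \<Rightarrow> real) \<Rightarrow> (nat \<Rightarrow> nat set) \<Rightarrow> real" where
  "bundle_sum m f X = (\<Sum>i\<in>{1..m}. \<Sum>j\<in>X i. f i j)"

lemma bundle_sum_pick:
  assumes "i \<in> {1..m}" "finite (X i)" "j \<notin> X i"
  shows "bundle_sum m f (X(i := insert j (X i))) = f i j + bundle_sum m f X"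
proof -
  let ?Y = "X(i := insert j (X i))"
  have "bundle_sum m f ?Y = (\<Sum>k\<in>?Y i. f i k) + (\<Sum>l\<in>{1..m} - {i}. \<Sum>k\<in>?Y l. f l k)"
    unfolding bundle_sum_def using assms(1) by (intro sum.remove) auto
  moreover have "bundle_sum m f X = (\<Sum>k\<in>X i. f i k) + (\<Sum>l\<in>{1..m} - {i}. \<Sum>k\<in>X l. f l k)"
    unfolding bundle_sum_def using assms(1) by (intro sum.remove) auto
  moreover have "(\<Sum>l\<in>{1..m} - {i}. \<Sum>k\<in>?Y l. f l k) = (\<Sum>l\<in>{1..m} - {i}. \<Sum>k\<in>X l. f l k)"
    by (intro sum.cong) auto
  moreover have "(\<Sum>k\<in>?Y i. f i k) = f i j + (\<Sum>k\<in>X i. f i k)"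
    using assms by simp
  ultimately show ?thesis by (simp only: add.assoc)
qed

text \<open>A firm leaves \<open>S\<close> when it picks, so it gains at most one worker
  \<open>p\<close>. Workers left at the end were available at that pick and hence are worth no more
  to the firm than \<open>p\<close>. The last conjunct carries the induction: it freezes the bundle
  of a firm that has already picked.\<close>

lemma run_round_bundle:
  assumes "run_round a X U S X' U'"
  shows "U' \<subseteq> U \<and>
    (X' i = X i \<and> (i \<in> S \<longrightarrow> (\<forall>j\<in>U'. a i j \<le> 0)) \<or>
     (\<exists>p\<in>U - U'. X' i = insert p (X i) \<and> a i p > 0 \<and> (\<forall>j\<in>U'. a i j \<le> a i p)))
    \<and> (i \<notin> S \<longrightarrow> X' i = X i)"
  using assms
proof (induction rule: run_round.induct)
  case (round_end S U X)
  then show ?case by (fastforce simp: positive_pair_def not_less)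
next
  case (round_pick k S p U X X' U')
  have sub: "U' \<subseteq> U - {p}" using round_pick.IH by simp
  show ?case
  proof (cases "i = k")
    case True
    have "a k j \<le> a k p" if "j \<in> U'" for j
    proof (cases "a k j > 0")
      case True
      then show ?thesis using round_pick.hyps sub that by blast
    qed (use round_pick.hyps in simp)
    then show ?thesis using True round_pick sub by auto
  next
    case False
    then show ?thesis using round_pick.IH sub by auto
  qed
qed

section \<open>Partial matchings as the invariant of the algorithm\<close>

locale market =
  fixes m n :: nat and a :: "nat \<Rightarrow> nat \<Rightarrow> real"
  assumes firm_exists: "m \<ge> 1"
    and nonneg: "\<And>i j. i \<in> {1..m} \<Longrightarrow> j \<in> {1..n} \<Longrightarrow> a i j \<ge> 0"
begin

text \<open>Positivity of assigned values is part of the invariant because \<open>delta\<close>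
  bounds only ratios with a positive numerator.\<close>

definition partial_matching :: "(nat \<Rightarrow> nat set) \<Rightarrow> nat set \<Rightarrow> bool" where
  "partial_matching X U \<longleftrightarrow>
     (\<Union>i\<in>{1..m}. X i) \<union> U = {1..n} \<and> disjoint_family_on X {1..m} \<and>
     (\<forall>i\<in>{1..m}. X i \<inter> U = {} \<and> (\<forall>j\<in>X i. a i j > 0))"

lemma partial_matchingD:
  assumes "partial_matching X U"
  shows "U \<subseteq> {1..n}" "i \<in> {1..m} \<Longrightarrow> finite (X i)" "i \<in> {1..m} \<Longrightarrow> X i \<subseteq> {1..n}"
    "i \<in> {1..m} \<Longrightarrow> X i \<inter> U = {}"
proof -
  show U: "U \<subseteq> {1..n}" using assms by (auto simp: partial_matching_def)
  show X: "X i \<subseteq> {1..n}" if "i \<in> {1..m}"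
    using assms that unfolding partial_matching_def by blast
  show "finite (X i)" if "i \<in> {1..m}"
    using X[OF that] finite_subset by blast
  show "X i \<inter> U = {}" if "i \<in> {1..m}"
    using assms that by (auto simp: partial_matching_def)
qed

lemma partial_matching_empty: "partial_matching (\<lambda>_. {}) {1..n}"
  by (simp add: partial_matching_def disjoint_family_on_def)

lemma partial_matching_pick:
  assumes "partial_matching X U" "i \<in> {1..m}" "j \<in> U" "a i j > 0"
  shows "partial_matching (X(i := insert j (X i))) (U - {j})"
proof -
  have "(\<Union>k\<in>{1..m}. (X(i := insert j (X i))) k) = insert j (\<Union>k\<in>{1..m}. X k)"
    using assms(2) by (auto split: if_splits)
  moreover have "\<forall>k\<in>{1..m}. j \<notin> X k"
    using assms(1,3) by (auto simp: partial_matching_def)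
  ultimately show ?thesis
    using assms unfolding partial_matching_def disjoint_family_on_def
    by (auto split: if_splits)
qed

lemma run_round_partial_matching:
  assumes "run_round a X U S X' U'" "partial_matching X U" "S \<subseteq> {1..m}"
  shows "partial_matching X' U'"
  using assms
proof (induction rule: run_round.induct)
  case (round_pick i S j U X X' U')
  then show ?case by (intro round_pick.IH partial_matching_pick) auto
qed simp

lemma run_rounds_partial_matching:
  assumes "run_rounds m a X U X' U'" "partial_matching X U"
  shows "partial_matching X' U' \<and> \<not> positive_pair a {1..m} U'"
  using assms
  by (induction rule: run_rounds.induct) (auto dest: run_round_partial_matching)

section \<open>Change of a potential along the run\<close>

text \<open>Each pick uses up one active firm, so there are at most \<open>card S\<close> picks. The
  round may stop earlier, which is where \<open>0 \<le> c\<close> enters.\<close>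

lemma run_round_bundle_sum_le:
  assumes "run_round a X U S X' U'" "partial_matching X U" "S \<subseteq> {1..m}" "0 \<le> c"
    and "\<And>i j. i \<in> S \<Longrightarrow> j \<in> U \<Longrightarrow> a i j > 0 \<Longrightarrow> f i j \<le> c"
  shows "bundle_sum m f X' \<le> bundle_sum m f X + c * real (card S)"
  using assms
proof (induction rule: run_round.induct)
  case (round_end S U X)
  then show ?case by simp
next
  case (round_pick i S j U X X' U')
  let ?Y = "X(i := insert j (X i))"
  have i: "i \<in> {1..m}" using round_pick by auto
  have "bundle_sum m f X' \<le> bundle_sum m f ?Y + c * real (card (S - {i}))"
    using round_pick i by (intro round_pick.IH partial_matching_pick) auto
  also have "bundle_sum m f ?Y = f i j + bundle_sum m f X"
    using i round_pick partial_matchingD(2,4)[of X U i] by (intro bundle_sum_pick) auto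
  also have "f i j \<le> c" using round_pick by auto
  also have "real (card (S - {i})) = real (card S) - 1"
    using round_pick finite_subset[of S "{1..m}"] card_gt_0_iff[of S]
    by (subst card_Diff_singleton) auto
  finally show ?case by (simp add: algebra_simps)
qed

text \<open>
  The picks of a round made before any firm of I is served do not increase the sum, the first
  pick by a firm of I decreases it by at least c (m - 1) v, and each of the at most m - 1 later
  picks increases it by at most c v.
\<close>

lemma run_round_bundle_sum_mono:
  assumes "run_round a X U S X' U'" "partial_matching X U" "S \<subseteq> {1..m}" "I \<subseteq> S" "0 \<le> c"
    and before: "\<And>i j. i \<in> {1..m} - I \<Longrightarrow> j \<in> {1..n} \<Longrightarrow> a i j > 0 \<Longrightarrow>
      (\<And>k. k \<in> I \<Longrightarrow> a k j \<le> a i j) \<Longrightarrow> f i j \<le> 0"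
    and at: "\<And>i j. i \<in> I \<Longrightarrow> j \<in> {1..n} \<Longrightarrow> a i j > 0 \<Longrightarrow>
      (\<And>k. k \<in> I \<Longrightarrow> a k j \<le> a i j) \<Longrightarrow> f i j \<le> - c * (real m - 1) * a i j"
    and after: "\<And>i j v. i \<in> {1..m} \<Longrightarrow> j \<in> {1..n} \<Longrightarrow> a i j > 0 \<Longrightarrow>
      (\<And>k. k \<in> I \<Longrightarrow> a k j \<le> v) \<Longrightarrow> f i j \<le> c * v"
    and "I \<noteq> {}"
  shows "bundle_sum m f X' \<le> bundle_sum m f X"
  using assms(1-4)
proof (induction rule: run_round.induct)
  case (round_end S U X)
  then show ?case by simp
next
  case (round_pick i S j U X X' U')
  let ?Y = "X(i := insert j (X i))"
  have i: "i \<in> {1..m}" and j: "j \<in> {1..n}"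
    using round_pick partial_matchingD(1) by blast+
  \<comment> \<open>By \<open>I \<subseteq> S\<close> no firm of \<open>I\<close> has been served
    yet, so the maximal pair dominates every value that these firms still see.\<close>
  have dom: "a k l \<le> a i j" if "k \<in> I" "l \<in> U" for k l
  proof (cases "a k l > 0")
    case True
    then show ?thesis using that round_pick by blast
  qed (use round_pick.hyps in simp)
  have Y: "bundle_sum m f ?Y = f i j + bundle_sum m f X"
    using i round_pick partial_matchingD(2,4)[of X U i] by (intro bundle_sum_pick) auto
  have pm: "partial_matching ?Y (U - {j})"
    using round_pick i by (intro partial_matching_pick) auto
  show ?case
  proof (cases "i \<in> I")
    case False
    have "bundle_sum m f X' \<le> bundle_sum m f ?Y"
      using round_pick.prems False pm by (intro round_pick.IH[OF pm]) auto
    moreover have "f i j \<le> 0"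
      using False i j round_pick dom by (intro before) auto
    ultimately show ?thesis using Y by simp
  next
    case True
    have "card (S - {i}) \<le> card ({1..m} - {i})"
      using round_pick by (intro card_mono) auto
    then have card: "real (card (S - {i})) \<le> real m - 1"
      using i by (auto simp: card_Diff_singleton)
    have c: "0 \<le> c * a i j" using \<open>0 \<le> c\<close> round_pick.hyps by simp
    \<comment> \<open>Since \<open>I \<subseteq> S - {i}\<close> fails, the induction hypothesis is
      out of reach; the rest of the round is bounded at once, with \<open>a i j\<close> as the fixed
      \<open>v\<close>.\<close>
    have "bundle_sum m f X' \<le> bundle_sum m f ?Y + c * a i j * real (card (S - {i}))"
    proof (rule run_round_bundle_sum_le[OF round_pick.hyps(5) pm _ c])
      show "S - {i} \<subseteq> {1..m}" using round_pick.prems by auto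
      fix k l assume "k \<in> S - {i}" "l \<in> U - {j}" "a k l > 0"
      then show "f k l \<le> c * a i j"
        using round_pick.prems partial_matchingD(1)[of X U] dom
        by (intro after) auto
    qed
    also have "\<dots> \<le> bundle_sum m f ?Y + c * a i j * (real m - 1)"
      using card c by (intro add_left_mono mult_left_mono)
    finally show ?thesis
      using Y at[OF True j] round_pick.hyps dom by (auto simp: algebra_simps)
  qed
qed

text \<open>Every round restarts with all firms active, so the bound for one round applies each time
  with the same \<open>I\<close>.\<close>

lemma run_rounds_bundle_sum_mono:
  assumes "run_rounds m a X U X' U'" "partial_matching X U"
    and "I \<subseteq> {1..m}" "I \<noteq> {}" "0 \<le> c"
    and "\<And>i j. i \<in> {1..m} - I \<Longrightarrow> j \<in> {1..n} \<Longrightarrow> a i j > 0 \<Longrightarrow>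
      (\<And>k. k \<in> I \<Longrightarrow> a k j \<le> a i j) \<Longrightarrow> f i j \<le> 0"
    and "\<And>i j. i \<in> I \<Longrightarrow> j \<in> {1..n} \<Longrightarrow> a i j > 0 \<Longrightarrow>
      (\<And>k. k \<in> I \<Longrightarrow> a k j \<le> a i j) \<Longrightarrow> f i j \<le> - c * (real m - 1) * a i j"
    and "\<And>i j v. i \<in> {1..m} \<Longrightarrow> j \<in> {1..n} \<Longrightarrow> a i j > 0 \<Longrightarrow>
      (\<And>k. k \<in> I \<Longrightarrow> a k j \<le> v) \<Longrightarrow> f i j \<le> c * v"
  shows "bundle_sum m f X' \<le> bundle_sum m f X"
  using assms(1,2)
proof (induction rule: run_rounds.induct)
  case (rounds_next U X X' U' X'' U'')
  have "bundle_sum m f X' \<le> bundle_sum m f X"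
    by (rule run_round_bundle_sum_mono[OF rounds_next.hyps(2) rounds_next.prems])
      (use assms in auto)
  moreover have "partial_matching X' U'"
    using run_round_partial_matching[OF rounds_next.hyps(2) rounds_next.prems] by simp
  ultimately show ?case using rounds_next.IH by simp
qed simp

section \<open>Envy between two firms along the run\<close>

lemma run_rounds_bundle_mono:
  assumes "run_rounds m a X U X' U'"
  shows "X i \<subseteq> X' i \<and> X' i - X i \<subseteq> U"
  using assms
proof (induction rule: run_rounds.induct)
  case (rounds_next U X X' U' X'' U'')
  then show ?case using run_round_bundle[OF rounds_next.hyps(2), of i] by auto
qed simp

text \<open>Only workers gained since the initial state are compared, so the induction hypothesis
  covers the rounds after the first. If \<open>k\<close> picks \<open>p\<close> in the first round,
  then \<open>p\<close> becomes the exempt worker, and the previously exempt \<open>g\<close> is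
  paid for by what \<open>i\<close> gains in that round.\<close>

lemma run_rounds_EF1:
  assumes "run_rounds m a X U X' U'" "partial_matching X U" "i \<in> {1..m}" "k \<in> {1..m}"
    and "X' k - X k \<noteq> {}"
  shows "\<exists>g\<in>X' k - X k. val a i (X' i - X i) \<ge> val a i (X' k - X k - {g})"
  using assms
proof (induction rule: run_rounds.induct)
  case (rounds_end U X)
  then show ?case by simp
next
  case (rounds_next U X Y V Z W)
  note i = \<open>i \<in> {1..m}\<close> and k = \<open>k \<in> {1..m}\<close>
  have pmY: "partial_matching Y V"
    using run_round_partial_matching[OF rounds_next.hyps(2) rounds_next.prems(1)] by simp
  have pmZ: "partial_matching Z W"
    using run_rounds_partial_matching[OF rounds_next.hyps(3) pmY] by simp
  have finite: "finite (Z i)" "finite (Z k)"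
    using pmZ i k partial_matchingD by auto
  have later: "Y l \<subseteq> Z l" "Z l - Y l \<subseteq> V" for l
    using run_rounds_bundle_mono[OF rounds_next.hyps(3), of l] by auto
  note round = run_round_bundle[OF rounds_next.hyps(2)]
  have XU: "X i \<inter> U = {}" "X k \<inter> U = {}"
    using rounds_next.prems i k partial_matchingD(4) by auto
  have gain: "val a i (Z i - X i) \<ge> val a i (Z i - Y i) \<and>
      (\<forall>g\<in>V. val a i (Z i - X i) \<ge> val a i (Z i - Y i) + a i g)"
  proof (cases "Y i = X i")
    case True
    \<comment> \<open>This rules out the picking alternative of \<open>run_round_bundle\<close>,
      leaving that no worker in \<open>V\<close> has positive value for \<open>i\<close>.\<close>
    moreover have "X i \<noteq> insert p (X i)" if "p \<in> U - V" for p
      using that XU(1) by blast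
    ultimately have "\<forall>j\<in>V. a i j \<le> 0" using round[of i] i by metis
    then show ?thesis using \<open>Y i = X i\<close> by auto
  next
    case False
    then obtain p where p: "p \<in> U - V" "Y i = insert p (X i)" "a i p > 0" "\<forall>j\<in>V. a i j \<le> a i p"
      using round[of i] by auto
    have eq: "Z i - X i = insert p (Z i - Y i)" using p(1,2) later(1)[of i] XU by blast
    have "val a i (Z i - X i) = a i p + val a i (Z i - Y i)"
      unfolding eq val_def using finite p(2) by (intro sum.insert) auto
    then show ?thesis using p by auto
  qed
  show ?case
  proof (cases "Z k - Y k = {}")
    case True
    \<comment> \<open>Firm \<open>k\<close> gains only its pick of this round; exempting it leaves
      value 0.\<close>
    then have Z: "Z k = Y k" using later(1)[of k] by blast
    then have "Y k \<noteq> X k" using rounds_next.prems(4) by blast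
    then obtain p where "p \<in> U - V" "Y k = insert p (X k)"
      using round[of k] by auto
    then have p: "Z k - X k = {p}" using Z XU(2) by blast
    have "0 \<le> val a i (Z i - X i)"
      unfolding val_def using i nonneg partial_matchingD(3)[OF pmZ i]
      by (intro sum_nonneg) auto
    then show ?thesis using p by (auto simp: val_def)
  next
    case False
    then obtain g where g: "g \<in> Z k - Y k" "val a i (Z k - Y k - {g}) \<le> val a i (Z i - Y i)"
      using rounds_next.IH[OF pmY i k] by auto
    have split: "val a i (Z k - Y k) = a i g + val a i (Z k - Y k - {g})"
      unfolding val_def using g finite by (intro sum.remove) auto
    show ?thesis
    proof (cases "Y k = X k")
      case True
      then show ?thesis using g gain by (intro bexI[of _ g]) auto
    next
      case False
      then obtain p where p: "p \<in> U - V" "Y k = insert p (X k)"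
        using round[of k] by auto
      have rest: "Z k - X k - {p} = Z k - Y k" using p(2) by blast
      have "g \<in> V" using g(1) later(2) by blast
      then have "val a i (Z i - Y i) + a i g \<le> val a i (Z i - X i)" using gain by blast
      then have "val a i (Z k - X k - {p}) \<le> val a i (Z i - X i)"
        unfolding rest using split g(2) by linarith
      moreover have "p \<in> Z k - X k" using p later(1)[of k] XU(2) by blast
      ultimately show ?thesis by blast
    qed
  qed
qed

section \<open>Maximal values and the ratio \<open>delta\<close>\<close>

lemma max_val_ge: "i \<in> {1..m} \<Longrightarrow> a i j \<le> max_val m a j"
  unfolding max_val_def by (intro Max_ge) auto

lemma max_val_le: "(\<And>i. i \<in> {1..m} \<Longrightarrow> a i j \<le> v) \<Longrightarrow> max_val m a j \<le> v"
  unfolding max_val_def using firm_exists by (intro Max.boundedI) auto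

lemma finite_ratios:
  "finite {a i j / max_val m a j | i j. i \<in> {1..m} \<and> j \<in> {1..n} \<and> a i j > 0}"
proof -
  have "{a i j / max_val m a j | i j. i \<in> {1..m} \<and> j \<in> {1..n} \<and> a i j > 0} \<subseteq>
    (\<lambda>(i, j). a i j / max_val m a j) ` ({1..m} \<times> {1..n})" by auto
  then show ?thesis by (rule finite_subset) auto
qed

lemma delta_mult_max_val_le:
  assumes "i \<in> {1..m}" "j \<in> {1..n}" "a i j > 0"
  shows "delta m n a * max_val m a j \<le> a i j"
proof -
  have "delta m n a \<le> a i j / max_val m a j"
    unfolding delta_def using assms finite_ratios by (auto intro!: Min_le)
  moreover have "max_val m a j > 0" using max_val_ge[of i j] assms by simp
  ultimately show ?thesis by (simp add: pos_le_divide_eq)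
qed

lemma delta_bounds: "0 \<le> delta m n a" "delta m n a \<le> 1"
proof -
  let ?R = "{a i j / max_val m a j | i j. i \<in> {1..m} \<and> j \<in> {1..n} \<and> a i j > 0}"
  have ratio: "0 \<le> r \<and> r \<le> 1" if "r \<in> ?R" for r
  proof -
    from that obtain i j where "r = a i j / max_val m a j" "i \<in> {1..m}" "a i j > 0" by auto
    then show ?thesis using max_val_ge[of i j] by (auto simp: divide_le_eq)
  qed
  have "0 \<le> delta m n a \<and> delta m n a \<le> 1"
  proof (cases "\<exists>i\<in>{1..m}. \<exists>j\<in>{1..n}. a i j > 0")
    case True
    then have "?R \<noteq> {}" by blast
    then have "Min ?R \<in> ?R" using finite_ratios Min_in by blast
    then show ?thesis using True ratio unfolding delta_def by presburger
  next
    case False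
    then show ?thesis by (simp only: delta_def if_False) simp
  qed
  then show "0 \<le> delta m n a" "delta m n a \<le> 1" by auto
qed

end

section \<open>Outputs of the algorithm: partition and EF1\<close>

locale gme_market = market +
  fixes X :: "nat \<Rightarrow> nat set"
  assumes gme: "gme_output m n a X"
begin

text \<open>When the loops stop no positive pair remains, so by nonnegativity leftover workers are
  worth 0 to all firms. Facts about the loop result \<open>X\<^sub>0\<close> therefore carry over to
  \<open>X\<close>.\<close>

lemma output_cases:
  obtains X\<^sub>0 U where "run_rounds m a (\<lambda>_. {}) {1..n} X\<^sub>0 U" "partial_matching X\<^sub>0 U"
    "\<And>i j. i \<in> {1..m} \<Longrightarrow> j \<in> U \<Longrightarrow> a i j = 0"
    "\<And>i. X\<^sub>0 i \<subseteq> X i" "\<And>i. X i - X\<^sub>0 i \<subseteq> U" "complete_matching m n X"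
proof -
  obtain X\<^sub>0 U r where run: "run_rounds m a (\<lambda>_. {}) {1..n} X\<^sub>0 U"
    and r: "\<forall>j\<in>U. r j \<in> {1..m}" and X: "X = (\<lambda>i. X\<^sub>0 i \<union> {j \<in> U. r j = i})"
    using gme unfolding gme_output_def by blast
  have pm: "partial_matching X\<^sub>0 U" and ended: "\<not> positive_pair a {1..m} U"
    using run_rounds_partial_matching[OF run partial_matching_empty] by auto
  have zero: "a i j = 0" if "i \<in> {1..m}" "j \<in> U" for i j
    using that ended nonneg[of i j] partial_matchingD(1)[OF pm]
    by (force simp: positive_pair_def)
  have "(\<Union>i\<in>{1..m}. X i) = (\<Union>i\<in>{1..m}. X\<^sub>0 i) \<union> U"
    unfolding X using r by blast
  moreover have "X i \<inter> X k = {}" if ik: "i \<in> {1..m}" "k \<in> {1..m}" "i \<noteq> k" for i k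
  proof -
    have "X\<^sub>0 i \<inter> X\<^sub>0 k = {}" "X\<^sub>0 i \<inter> U = {}" "X\<^sub>0 k \<inter> U = {}"
      using pm ik unfolding partial_matching_def disjoint_family_on_def by auto
    then show ?thesis using ik(3) unfolding X by blast
  qed
  ultimately have "complete_matching m n X"
    using pm by (simp add: complete_matching_def partial_matching_def disjoint_family_on_def)
  moreover have "X\<^sub>0 i \<subseteq> X i" "X i - X\<^sub>0 i \<subseteq> U" for i
    unfolding X by auto
  ultimately show ?thesis using that[OF run pm zero] by blast
qed

lemma complete_matching_output: "complete_matching m n X"
  by (rule output_cases)

lemma bundle_subset: "i \<in> {1..m} \<Longrightarrow> X i \<subseteq> {1..n}"
  using complete_matching_output unfolding complete_matching_def by blast

lemma finite_bundle: "i \<in> {1..m} \<Longrightarrow> finite (X i)"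
  using bundle_subset finite_subset by blast

lemma EF1_output: "EF1 m a X"
  unfolding EF1_def
proof (intro ballI impI)
  fix i k assume i: "i \<in> {1..m}" and k: "k \<in> {1..m}" and ne: "X k \<noteq> {}"
  obtain X\<^sub>0 U where o: "run_rounds m a (\<lambda>_. {}) {1..n} X\<^sub>0 U" "partial_matching X\<^sub>0 U"
    "\<And>i j. i \<in> {1..m} \<Longrightarrow> j \<in> U \<Longrightarrow> a i j = 0"
    "\<And>i. X\<^sub>0 i \<subseteq> X i" "\<And>i. X i - X\<^sub>0 i \<subseteq> U" "complete_matching m n X"
    by (fact output_cases)
  have drop: "val a i (X l - G) = val a i (X\<^sub>0 l - G)" if "l \<in> {1..m}" for l G
    unfolding val_def
  proof (rule sum.mono_neutral_right)
    show "finite (X l - G)" using finite_bundle[OF that] by blast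
    show "X\<^sub>0 l - G \<subseteq> X l - G" using o(4) by blast
    show "\<forall>j\<in>(X l - G) - (X\<^sub>0 l - G). a i j = 0"
      using o(3)[OF i] o(5)[of l] by blast
  qed
  show "\<exists>g\<in>X k. val a i (X i) \<ge> val a i (X k - {g})"
  proof (cases "X\<^sub>0 k = {}")
    case True
    \<comment> \<open>Here \<open>X k\<close> consists of worthless leftover workers, so any of them
      serves as the exempt one.\<close>
    have "0 \<le> val a i (X\<^sub>0 i)"
      unfolding val_def using partial_matchingD(3)[OF o(2) i] i nonneg
      by (intro sum_nonneg) auto
    then show ?thesis using True ne drop[OF k] drop[OF i, of "{}"] by (auto simp: val_def)
  next
    case False
    then obtain g where "g \<in> X\<^sub>0 k" "val a i (X\<^sub>0 i) \<ge> val a i (X\<^sub>0 k - {g})"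
      using run_rounds_EF1[OF o(1) partial_matching_empty i k] by auto
    then show ?thesis using drop[OF k] drop[OF i, of "{}"] o(4)[of k] by auto
  qed
qed

text \<open>The potential is 0 on empty bundles, does not increase in any round, and ignores
  leftover workers. The assumptions treat picks before, at and after the first pick by
  \<open>I\<close> in a round.\<close>

lemma bundle_sum_output_le_0:
  assumes "I \<subseteq> {1..m}" "I \<noteq> {}" "0 \<le> c"
    and before: "\<And>i j. i \<in> {1..m} - I \<Longrightarrow> j \<in> {1..n} \<Longrightarrow> a i j > 0 \<Longrightarrow>
      (\<And>k. k \<in> I \<Longrightarrow> a k j \<le> a i j) \<Longrightarrow> f i j \<le> 0"
    and at: "\<And>i j. i \<in> I \<Longrightarrow> j \<in> {1..n} \<Longrightarrow> a i j > 0 \<Longrightarrow>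
      (\<And>k. k \<in> I \<Longrightarrow> a k j \<le> a i j) \<Longrightarrow> f i j \<le> - c * (real m - 1) * a i j"
    and after: "\<And>i j v. i \<in> {1..m} \<Longrightarrow> j \<in> {1..n} \<Longrightarrow> a i j > 0 \<Longrightarrow>
      (\<And>k. k \<in> I \<Longrightarrow> a k j \<le> v) \<Longrightarrow> f i j \<le> c * v"
    and leftover: "\<And>i j. i \<in> {1..m} \<Longrightarrow> j \<in> {1..n} \<Longrightarrow>
      (\<And>k. k \<in> {1..m} \<Longrightarrow> a k j = 0) \<Longrightarrow> f i j = 0"
  shows "bundle_sum m f X \<le> 0"
proof -
  obtain X\<^sub>0 U where o: "run_rounds m a (\<lambda>_. {}) {1..n} X\<^sub>0 U" "partial_matching X\<^sub>0 U"
    "\<And>i j. i \<in> {1..m} \<Longrightarrow> j \<in> U \<Longrightarrow> a i j = 0"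
    "\<And>i. X\<^sub>0 i \<subseteq> X i" "\<And>i. X i - X\<^sub>0 i \<subseteq> U" "complete_matching m n X"
    by (fact output_cases)
  have "bundle_sum m f X = bundle_sum m f X\<^sub>0"
    unfolding bundle_sum_def
  proof (rule sum.cong[OF refl], rule sum.mono_neutral_right)
    fix i assume i: "i \<in> {1..m}"
    show "finite (X i)" using i by (rule finite_bundle)
    show "X\<^sub>0 i \<subseteq> X i" using o(4) .
    show "\<forall>j\<in>X i - X\<^sub>0 i. f i j = 0"
    proof
      fix j assume "j \<in> X i - X\<^sub>0 i"
      then have "j \<in> U" using o(5) by blast
      then show "f i j = 0"
        using leftover[OF i] o(3) partial_matchingD(1)[OF o(2)] by blast
    qed
  qed
  also have "\<dots> \<le> bundle_sum m f (\<lambda>_. {})"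
    by (rule run_rounds_bundle_sum_mono[OF o(1) partial_matching_empty assms(1-3)])
      (use before at after in auto)
  finally show ?thesis by (simp add: bundle_sum_def)
qed

section \<open>The value of a worker for its employer\<close>

text \<open>For a worker the sum has exactly one term, that of its employer, since the bundles
  partition the workers.\<close>

definition pay :: "nat \<Rightarrow> real" where
  "pay j = (\<Sum>i | i \<in> {1..m} \<and> j \<in> X i. a i j)"

lemma pay_eq:
  assumes "i \<in> {1..m}" "j \<in> X i"
  shows "pay j = a i j"
proof -
  have "{k. k \<in> {1..m} \<and> j \<in> X k} = {i}"
    using assms complete_matching_output
    unfolding complete_matching_def disjoint_family_on_def by blast
  then show ?thesis by (simp add: pay_def)
qed

text \<open>Turns a potential whose weight does not depend on the firm into a sum over all workers,
  as needed for \<open>opt_welfare\<close> and for coalitions.\<close>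

lemma bundle_sum_worker: "bundle_sum m (\<lambda>i. g) X = (\<Sum>j\<in>{1..n}. g j)"
proof -
  have part: "(\<Union>i\<in>{1..m}. X i) = {1..n}" "disjoint_family_on X {1..m}"
    using complete_matching_output by (auto simp: complete_matching_def)
  then have "(\<Sum>j\<in>(\<Union>i\<in>{1..m}. X i). g j) = (\<Sum>i\<in>{1..m}. \<Sum>j\<in>X i. g j)"
    using part(2) finite_bundle by (intro sum.UNION_disjoint) (auto simp: disjoint_family_on_def)
  then show ?thesis using part(1) by (simp add: bundle_sum_def)
qed

lemma owner:
  assumes "j \<in> {1..n}"
  obtains i where "i \<in> {1..m}" "j \<in> X i"
  using assms complete_matching_output that unfolding complete_matching_def by blast

text \<open>A worker hired in the loops has positive value for its employer, so its ratio is among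
  those minimized by \<open>delta\<close>; a leftover worker has no positive value anywhere.\<close>

lemma delta_mult_max_val_le_pay:
  assumes "j \<in> {1..n}"
  shows "delta m n a * max_val m a j \<le> pay j"
proof -
  obtain X\<^sub>0 U where o: "run_rounds m a (\<lambda>_. {}) {1..n} X\<^sub>0 U" "partial_matching X\<^sub>0 U"
    "\<And>i j. i \<in> {1..m} \<Longrightarrow> j \<in> U \<Longrightarrow> a i j = 0"
    "\<And>i. X\<^sub>0 i \<subseteq> X i" "\<And>i. X i - X\<^sub>0 i \<subseteq> U" "complete_matching m n X"
    by (fact output_cases)
  obtain i where i: "i \<in> {1..m}" "j \<in> X i" using owner[OF assms] .
  show ?thesis
  proof (cases "j \<in> U")
    case True
    then have "max_val m a j \<le> 0" using o(3) by (intro max_val_le) auto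
    then show ?thesis
      using pay_eq[OF i] o(3)[OF i(1) True] delta_bounds(1) by (simp add: mult_nonneg_nonpos)
  next
    case False
    then have "j \<in> X\<^sub>0 i" using i(2) o(5)[of i] by blast
    then have "a i j > 0" using o(2) i(1) by (auto simp: partial_matching_def)
    then show ?thesis using pay_eq[OF i] delta_mult_max_val_le[OF i(1) assms] by simp
  qed
qed

lemma pay_nonneg: "j \<in> {1..n} \<Longrightarrow> 0 \<le> pay j"
  using owner pay_eq nonneg by metis

lemma val_output: "i \<in> {1..m} \<Longrightarrow> (\<Sum>j\<in>X i. pay j) = val a i (X i)"
  unfolding val_def by (intro sum.cong) (auto simp: pay_eq)

lemma welfare_eq: "welfare m a X = (\<Sum>j\<in>{1..n}. pay j)"
  unfolding welfare_def bundle_sum_worker[of pay, symmetric] bundle_sum_def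
  by (intro sum.cong) (auto simp: val_output)

section \<open>The welfare bound\<close>

lemma welfare_output:
  assumes "opt_welfare m n a > 0"
  shows "welfare m a X / opt_welfare m n a \<ge> welfare_bound m (delta m n a)"
proof -
  let ?t = "delta m n a"
  \<comment> \<open>The coefficient of \<open>max_val m a j\<close> is m times
    \<open>welfare_bound m ?t\<close>, so the potential of \<open>X\<close> is m times the welfare
    shortfall to be excluded.\<close>
  define f where "f i j = (1 + ?t * (real m - 1)) * max_val m a j - real m * a i j" for i j
  have "bundle_sum m f X \<le> 0"
  proof (rule bundle_sum_output_le_0[of "{1..m}" "1 - ?t"])
    show "{1..m} \<noteq> {}" "0 \<le> 1 - ?t" using firm_exists delta_bounds by auto
  next
    fix i j assume "i \<in> {1..m}" "\<And>k. k \<in> {1..m} \<Longrightarrow> a k j \<le> a i j"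
    then have "max_val m a j = a i j" using max_val_le max_val_ge by (intro antisym) auto
    then show "f i j \<le> - (1 - ?t) * (real m - 1) * a i j" by (simp add: f_def algebra_simps)
  next
    fix i j v
    assume ij: "i \<in> {1..m}" "j \<in> {1..n}" "a i j > 0" and v: "\<And>k. k \<in> {1..m} \<Longrightarrow> a k j \<le> v"
    have "f i j \<le> (1 + ?t * (real m - 1)) * max_val m a j - real m * (?t * max_val m a j)"
      unfolding f_def using delta_mult_max_val_le[OF ij] by (intro diff_left_mono mult_left_mono) auto
    also have "\<dots> = (1 - ?t) * max_val m a j" by (simp add: algebra_simps)
    also have "\<dots> \<le> (1 - ?t) * v"
      using delta_bounds v by (intro mult_left_mono max_val_le) auto
    finally show "f i j \<le> (1 - ?t) * v" .
  next
    fix i j assume "i \<in> {1..m}" "\<And>k. k \<in> {1..m} \<Longrightarrow> a k j = 0"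
    then have "max_val m a j = 0" "a i j = 0"
      using max_val_le[of j 0] max_val_ge[of i j] by auto
    then show "f i j = 0" by (simp add: f_def)
  qed auto
  \<comment> \<open>Writing \<open>pay j\<close> for \<open>a i j\<close> removes the dependence on
    the firm.\<close>
  also have "bundle_sum m f X =
      bundle_sum m (\<lambda>i j. (1 + ?t * (real m - 1)) * max_val m a j - real m * pay j) X"
    unfolding bundle_sum_def f_def by (intro sum.cong) (auto simp: pay_eq)
  also have "\<dots> = (1 + ?t * (real m - 1)) * opt_welfare m n a - real m * welfare m a X"
    unfolding bundle_sum_worker by (simp add: sum_subtractf sum_distrib_left opt_welfare_def welfare_eq)
  finally have "(1 + ?t * (real m - 1)) * opt_welfare m n a \<le> real m * welfare m a X" by simp
  moreover have "welfare_bound m ?t = (1 + ?t * (real m - 1)) / real m"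
    using firm_exists by (simp add: welfare_bound_def field_simps)
  ultimately have "welfare_bound m ?t * opt_welfare m n a \<le> welfare m a X"
    using firm_exists by (simp add: divide_le_eq mult.commute)
  then show ?thesis using assms by (simp add: pos_le_divide_eq)
qed

section \<open>The two core bounds\<close>

lemma Max_image_ge:
  assumes "I \<subseteq> {1..m}" "i \<in> I"
  shows "a i j \<le> Max ((\<lambda>i. a i j) ` I)"
  using assms finite_subset[OF assms(1)] by (intro Max_ge) auto

lemma Max_image_le:
  assumes "I \<subseteq> {1..m}" "I \<noteq> {}" "\<And>i. i \<in> I \<Longrightarrow> a i j \<le> v"
  shows "Max ((\<lambda>i. a i j) ` I) \<le> v"
  using assms finite_subset[OF assms(1)] by (intro Max.boundedI) auto

lemma core_ratio_ge:
  assumes "\<alpha> \<ge> 0" "\<And>i. i \<in> {1..m} \<Longrightarrow> x i \<ge> 0" "\<And>j. j \<in> {1..n} \<Longrightarrow> y j \<ge> 0"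
    "local_financing m a X x y" "in_core m n a \<alpha> x y"
  shows "core_ratio m n a X \<ge> ennreal \<alpha>"
  unfolding core_ratio_def using assms by (intro Sup_upper) blast

text \<open>With all value paid out as wages, the coalition inequality already holds worker by
  worker.\<close>

lemma core_ratio_ge_delta: "core_ratio m n a X \<ge> ennreal (delta m n a)"
proof (rule core_ratio_ge)
  show "local_financing m a X (\<lambda>_. 0) pay"
    by (simp add: local_financing_def val_output)
  show "in_core m n a (delta m n a) (\<lambda>_. 0) pay"
    unfolding in_core_def
  proof (intro allI impI)
    fix I T assume IT: "I \<noteq> {} \<and> I \<subseteq> {1..m} \<and> T \<subseteq> {1..n}"
    have "delta m n a * Max ((\<lambda>i. a i j) ` I) \<le> pay j" if "j \<in> T" for j
    proof -
      have "Max ((\<lambda>i. a i j) ` I) \<le> max_val m a j"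
        using IT max_val_ge by (intro Max_image_le) auto
      then have "delta m n a * Max ((\<lambda>i. a i j) ` I) \<le> delta m n a * max_val m a j"
        using delta_bounds by (intro mult_left_mono) auto
      also have "\<dots> \<le> pay j" using that IT by (intro delta_mult_max_val_le_pay) auto
      finally show ?thesis .
    qed
    then show "delta m n a * (\<Sum>j\<in>T. Max ((\<lambda>i. a i j) ` I)) \<le> (\<Sum>i\<in>I. 0) + sum pay T"
      unfolding sum_distrib_left by (simp add: sum_mono)
  qed
qed (auto simp: delta_bounds pay_nonneg)

text \<open>What \<open>T\<close> would be worth to \<open>I\<close> beyond its wages
  \<open>pay\<close> is charged to the values that the firms of \<open>I\<close> obtain
  themselves.\<close>

lemma coalition_loss_le:
  assumes I: "I \<subseteq> {1..m}" "I \<noteq> {}" and T: "T \<subseteq> {1..n}"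
  shows "(\<Sum>j\<in>T. Max ((\<lambda>i. a i j) ` I)) \<le>
    (\<Sum>j\<in>T. pay j) + (1 - delta m n a) * (real m - 1) * (\<Sum>i\<in>I. val a i (X i))"
proof -
  define t where "t = delta m n a"
  define w where "w j = Max ((\<lambda>i. a i j) ` I)" for j
  define c where "c = (1 - t) * (real m - 1)"
  \<comment> \<open>The first term is the loss on a worker of \<open>T\<close>, the second a payment
    made at every pick by \<open>I\<close>. A pick of value v pays (1 - t)(m - 1)v, enough for m - 1
    later losses of at most (1 - t)v. The local \<open>c\<close> contains the factor m - 1, while
    the constant passed to \<open>bundle_sum_output_le_0\<close> is 1 - t.\<close>
  define f where "f i j = (if j \<in> T then w j - a i j else 0) - (if i \<in> I then c * a i j else 0)" for i j
  have t: "0 \<le> t" "t \<le> 1" using delta_bounds by (auto simp: t_def)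
  have c: "0 \<le> c" using t firm_exists by (simp add: c_def)
  have w_le: "w j \<le> v" if "\<And>k. k \<in> I \<Longrightarrow> a k j \<le> v" for j v
    unfolding w_def using I that by (rule Max_image_le)
  have "bundle_sum m f X \<le> 0"
  proof (rule bundle_sum_output_le_0[of I "1 - t"])
    fix i j assume "i \<in> {1..m} - I" "\<And>k. k \<in> I \<Longrightarrow> a k j \<le> a i j"
    then show "f i j \<le> 0" using w_le[of j "a i j"] by (simp add: f_def)
  next
    fix i j assume "i \<in> I" "\<And>k. k \<in> I \<Longrightarrow> a k j \<le> a i j"
    then show "f i j \<le> - (1 - t) * (real m - 1) * a i j"
      using w_le[of j "a i j"] by (simp add: f_def c_def algebra_simps)
  next
    fix i j v
    assume ij: "i \<in> {1..m}" "j \<in> {1..n}" "a i j > 0" and v: "\<And>k. k \<in> I \<Longrightarrow> a k j \<le> v"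
    obtain k where k: "k \<in> I" using I by auto
    \<comment> \<open>Needed for workers outside \<open>T\<close>, whose weight is at most
      0.\<close>
    have v0: "0 \<le> v" using v[OF k] nonneg[of k j] k I ij by force
    have "w j \<le> max_val m a j" using I max_val_ge by (intro w_le) auto
    then have "t * w j \<le> t * max_val m a j" using t by (intro mult_left_mono) auto
    also have "\<dots> \<le> a i j" unfolding t_def using ij by (rule delta_mult_max_val_le)
    finally have "w j - a i j \<le> (1 - t) * w j" by (simp add: algebra_simps)
    also have "\<dots> \<le> (1 - t) * v" using t v by (intro mult_left_mono w_le) auto
    finally have "w j - a i j \<le> (1 - t) * v" .
    moreover have "0 \<le> (1 - t) * v" "0 \<le> c * a i j" using v0 t c ij by auto
    ultimately show "f i j \<le> (1 - t) * v" by (auto simp: f_def)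
  next
    fix i j assume "i \<in> {1..m}" and zero: "\<And>k. k \<in> {1..m} \<Longrightarrow> a k j = 0"
    moreover have "w j = 0"
    proof (rule antisym)
      show "w j \<le> 0" using I zero by (intro w_le) auto
      obtain k where "k \<in> I" using I by auto
      then show "0 \<le> w j" using Max_image_ge[OF I(1), of k j] zero[of k] I by (auto simp: w_def)
    qed
    ultimately show "f i j = 0" by (simp add: f_def)
  qed (use I t in auto)
  also have "bundle_sum m f X = bundle_sum m (\<lambda>i j. if j \<in> T then w j - pay j else 0) X -
      (\<Sum>i\<in>{1..m}. if i \<in> I then c * val a i (X i) else 0)"
    unfolding bundle_sum_def f_def sum_subtractf[symmetric] val_def
    by (intro sum.cong refl) (auto simp: pay_eq sum_subtractf sum_distrib_left intro!: sum.cong)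
  also have "(\<Sum>i\<in>{1..m}. if i \<in> I then c * val a i (X i) else 0) = c * (\<Sum>i\<in>I. val a i (X i))"
    using I(1) by (simp add: sum.If_cases sum_distrib_left Int_absorb1)
  also have "bundle_sum m (\<lambda>i j. if j \<in> T then w j - pay j else 0) X = (\<Sum>j\<in>T. w j - pay j)"
    unfolding bundle_sum_worker using T by (simp add: sum.If_cases Int_absorb1)
  finally show ?thesis by (simp add: sum_subtractf w_def c_def t_def)
qed

text \<open>The choice of \<alpha> gives \<alpha> * d = 1 - \<alpha>, so scaling
  \<open>coalition_loss_le\<close> by \<alpha> turns its right-hand side into exactly the profits of
  \<open>I\<close> plus the wages of \<open>T\<close>.\<close>

lemma core_ratio_ge_inverse:
  "core_ratio m n a X \<ge> ennreal (1 / (real m - (real m - 1) * delta m n a))"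
proof -
  define d where "d = (1 - delta m n a) * (real m - 1)"
  define \<alpha> where "\<alpha> = 1 / (1 + d)"
  have d: "0 \<le> d" using delta_bounds firm_exists by (simp add: d_def)
  have \<alpha>: "0 \<le> \<alpha>" "\<alpha> \<le> 1" "\<alpha> * d = 1 - \<alpha>"
    using d by (auto simp: \<alpha>_def field_simps)
  have "core_ratio m n a X \<ge> ennreal \<alpha>"
  proof (rule core_ratio_ge)
    show "local_financing m a X (\<lambda>i. (1 - \<alpha>) * val a i (X i)) (\<lambda>j. \<alpha> * pay j)"
      by (simp add: local_financing_def sum_distrib_left[symmetric] val_output algebra_simps)
    show "in_core m n a \<alpha> (\<lambda>i. (1 - \<alpha>) * val a i (X i)) (\<lambda>j. \<alpha> * pay j)"
      unfolding in_core_def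
    proof (intro allI impI)
      fix I T assume IT: "I \<noteq> {} \<and> I \<subseteq> {1..m} \<and> T \<subseteq> {1..n}"
      then have "\<alpha> * (\<Sum>j\<in>T. Max ((\<lambda>i. a i j) ` I)) \<le>
          \<alpha> * ((\<Sum>j\<in>T. pay j) + d * (\<Sum>i\<in>I. val a i (X i)))"
        unfolding d_def using \<alpha> by (intro mult_left_mono coalition_loss_le) auto
      also have "\<dots> = (\<Sum>i\<in>I. (1 - \<alpha>) * val a i (X i)) + (\<Sum>j\<in>T. \<alpha> * pay j)"
        unfolding \<alpha>(3)[symmetric] sum_distrib_left[symmetric] by (simp add: algebra_simps)
      finally show "\<alpha> * (\<Sum>j\<in>T. Max ((\<lambda>i. a i j) ` I)) \<le>
        (\<Sum>i\<in>I. (1 - \<alpha>) * val a i (X i)) + (\<Sum>j\<in>T. \<alpha> * pay j)" .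
    qed
  next
    fix i assume i: "i \<in> {1..m}"
    then have "0 \<le> val a i (X i)"
      unfolding val_def using bundle_subset[OF i] nonneg by (intro sum_nonneg) auto
    then show "0 \<le> (1 - \<alpha>) * val a i (X i)" using \<alpha> by simp
  qed (auto simp: \<alpha> pay_nonneg)
  moreover have "\<alpha> = 1 / (real m - (real m - 1) * delta m n a)"
    unfolding \<alpha>_def d_def by (simp add: algebra_simps)
  ultimately show ?thesis by simp
qed

end

theorem theorem5:
  fixes m n :: nat and a :: "nat \<Rightarrow> nat \<Rightarrow> real" and X :: "nat \<Rightarrow> nat set"
  assumes "m \<ge> 1"
    and "\<And>i j. i \<in> {1..m} \<Longrightarrow> j \<in> {1..n} \<Longrightarrow> a i j \<ge> 0"
    and "gme_output m n a X"
  shows "complete_matching m n X \<and> EF1 m a X \<and>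
    core_ratio m n a X \<ge> ennreal (core_bound m (delta m n a)) \<and>
    (opt_welfare m n a > 0 \<longrightarrow>
       welfare m a X / opt_welfare m n a \<ge> welfare_bound m (delta m n a))"
proof -
  interpret gme_market m n a X
    using assms by unfold_locales
  have "core_ratio m n a X \<ge> ennreal (core_bound m (delta m n a))"
    using core_ratio_ge_delta core_ratio_ge_inverse by (simp add: core_bound_def max_def)
  then show ?thesis
    using complete_matching_output EF1_output welfare_output by blast
qed

end
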